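(* Let $n\ge 1$ and let $M\in\mathbb{C}^{n\times n}$ be a self-adjoint positive semidefinite matrix. Then $$ M\circ \overline{M}\succeq \frac{1}{n}\,(\operatorname{diag} M)(\operatorname{diag} M)^T . $$
   Context: A matrix $M\in\mathbb{C}^{n\times n}$ is positive semidefinite if $c^*Mc\ge 0$ for all $c\in\mathbb{C}^n$ (so $M$ is necessarily self-adjoint). For self-adjoint matrices, $M\succeq N$ means that $M-N$ is positive semidefinite. For $M,N\in\mathbb{C}^{n\times n}$, $M\circ N$ is the Hadamard (entrywise) product, $(M\circ N)_{j,k}=M_{j,k}N_{j,k}$. $\overline{M}$ is the matrix with entries $(\overline{M})_{j,k}=\overline{M_{j,k}}$. $\operatorname{diag} M=(M_{1,1},\dots,M_{n,n})^T$ is the column vector of diagonal entries of $M$. *)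

theory Defs
  imports "HOL-Analysis.Analysis"
begin

definition mat_cnj :: "complex^'n^'m \<Rightarrow> complex^'n^'m" where
  "mat_cnj M = (\<chi> i j. cnj (M $ i $ j))"

definition self_adjoint :: "complex^'n^'n \<Rightarrow> bool" where
  "self_adjoint M \<longleftrightarrow> transpose (mat_cnj M) = M"

(* The order is the one of HOL-Library.Complex_Order: 0 \<le> z says that z is real and nonnegative. *)
definition pos_semidef :: "complex^'n^'n \<Rightarrow> bool" where
  "pos_semidef M \<longleftrightarrow> (\<forall>c. 0 \<le> (\<Sum>i\<in>UNIV. cnj (c $ i) * (M *v c) $ i))"

(* The comparison is meant for self-adjoint matrices only, so self-adjointness is built in. *)
definition loewner_ge :: "complex^'n^'n \<Rightarrow> complex^'n^'n \<Rightarrow> bool" (infix \<open>\<succeq>\<close> 50) where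
  "M \<succeq> N \<longleftrightarrow> self_adjoint M \<and> self_adjoint N \<and> pos_semidef (M - N)"

definition hadamard :: "complex^'n^'m \<Rightarrow> complex^'n^'m \<Rightarrow> complex^'n^'m" (infixl \<open>\<odot>\<close> 70) where
  "M \<odot> N = (\<chi> i j. M $ i $ j * N $ i $ j)"

(* The diagonal is an n x 1 matrix. The type of columnvector leaves the number of columns
   open, so the column index type 1 has to be given. *)
definition diag_col :: "complex^'n^'n \<Rightarrow> complex^1^'n" where
  "diag_col M = columnvector (\<chi> i. M $ i $ i)"

end

theory Submission
  imports Defs
begin

text \<open>
  Write \<open>M = A A\<^sup>*\<close> with \<open>A\<close> square of the same size \<open>n\<close>, and for a vector \<open>c\<close> put
  \<open>B = A\<^sup>* diag(c) A\<close>. The value at \<open>c\<close> of the form of the Hadamard product of \<open>M\<close> with its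
  conjugate is \<open>tr (diag(c)\<^sup>* M diag(c) M) = tr (B\<^sup>* B)\<close>, the squared Frobenius norm of \<open>B\<close>,
  while the form of \<open>(diag M) (diag M)\<^sup>T\<close> has the value \<open>\<bar>tr B\<bar>\<^sup>2\<close>, because
  \<open>tr B = tr (diag(c) A A\<^sup>*) = \<Sum>\<^sub>k c\<^sub>k M\<^sub>k\<^sub>k\<close>. The Cauchy--Schwarz inequality for the \<open>n\<close> diagonal
  entries of \<open>B\<close> gives \<open>\<bar>tr B\<bar>\<^sup>2 \<le> n \<Sum>\<^sub>p \<bar>B\<^sub>p\<^sub>p\<bar>\<^sup>2\<close>, and dropping the off-diagonal entries
  of \<open>B\<close> from the Frobenius norm yields the claim. The constant \<open>1/n\<close> is thus the reciprocal of
  the number of columns of \<open>A\<close>.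

  The factorization (\<open>hermitian_psd_factorization\<close>) is a Cholesky decomposition: one index is
  split off, and the Schur complement on the remaining indices is again positive semidefinite
  (\<open>schur_complement_psd\<close>). For this induction matrices are functions of two indices, used on a
  finite set of indices that varies.
\<close>

section \<open>Cholesky factorization of positive semidefinite matrices\<close>

definition herm_form :: "'a set \<Rightarrow> ('a \<Rightarrow> 'a \<Rightarrow> complex) \<Rightarrow> ('a \<Rightarrow> complex) \<Rightarrow> complex" where
  "herm_form S M c = (\<Sum>i\<in>S. \<Sum>j\<in>S. cnj (c i) * M i j * c j)"

definition hermitian_on :: "'a set \<Rightarrow> ('a \<Rightarrow> 'a \<Rightarrow> complex) \<Rightarrow> bool" where
  "hermitian_on S M \<longleftrightarrow> (\<forall>i\<in>S. \<forall>j\<in>S. cnj (M i j) = M j i)"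

definition psd_on :: "'a set \<Rightarrow> ('a \<Rightarrow> 'a \<Rightarrow> complex) \<Rightarrow> bool" where
  "psd_on S M \<longleftrightarrow> (\<forall>c. 0 \<le> herm_form S M c)"

text \<open>If the diagonal entry \<open>M p p\<close> is zero, so is the subtracted term, since \<open>x / 0 = 0\<close>. This is
  the right convention: the row of \<open>p\<close> then vanishes, by \<open>psd_zero_diagonal_row\<close>.\<close>

definition schur_complement :: "'a \<Rightarrow> ('a \<Rightarrow> 'a \<Rightarrow> complex) \<Rightarrow> 'a \<Rightarrow> 'a \<Rightarrow> complex" where
  "schur_complement p M i j = M i j - M i p * M p j / M p p"

lemma herm_form_insert:
  assumes "finite S" "p \<notin> S" "hermitian_on (insert p S) M"
  defines "u \<equiv> \<lambda>c. \<Sum>j\<in>S. M p j * c j"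
  shows "herm_form (insert p S) M c =
    cnj (c p) * M p p * c p + cnj (c p) * u c + cnj (u c) * c p + herm_form S M c"
proof -
  have "cnj (u c) * c p = (\<Sum>i\<in>S. cnj (c i) * M i p * c p)"
    unfolding u_def cnj_sum sum_distrib_right
    by (rule sum.cong) (use assms(3) in \<open>auto simp: hermitian_on_def\<close>)
  moreover have "cnj (c p) * u c = (\<Sum>j\<in>S. cnj (c p) * M p j * c j)"
    unfolding u_def sum_distrib_left by (simp add: mult.assoc)
  ultimately show ?thesis
    using assms(1,2) by (simp add: herm_form_def sum.distrib)
qed

lemma herm_form_cong:
  "(\<And>i. i \<in> S \<Longrightarrow> c i = d i) \<Longrightarrow> herm_form S M c = herm_form S M d"
  by (simp add: herm_form_def)

lemma herm_form_rank_one: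
  assumes "hermitian_on (insert p S) M"
  shows "(\<Sum>i\<in>S. \<Sum>j\<in>S. cnj (c i) * (M i p * M p j) * c j) =
    cnj (\<Sum>j\<in>S. M p j * c j) * (\<Sum>j\<in>S. M p j * c j)"
  unfolding cnj_sum sum_product
  by (intro sum.cong) (use assms in \<open>auto simp: hermitian_on_def\<close>)

lemma herm_form_indicator:
  assumes "finite S" "q \<in> S"
  shows "herm_form S M (\<lambda>i. if i = q then 1 else 0) = M q q"
proof -
  have "herm_form S M (\<lambda>i. if i = q then 1 else 0) =
      (\<Sum>i\<in>S. \<Sum>j\<in>S. if j = q then (if i = q then M i j else 0) else 0)"
    unfolding herm_form_def by (intro sum.cong) auto
  then show ?thesis using assms by simp
qed

lemma hermitian_diag_real:
  assumes "hermitian_on S M" "p \<in> S"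
  shows "cnj (M p p) = M p p"
  using assms by (auto simp: hermitian_on_def)

lemma psd_diag_nonneg:
  assumes "finite S" "psd_on S M" "p \<in> S"
  shows "0 \<le> M p p"
  using assms herm_form_indicator[of S p M] unfolding psd_on_def by metis

text \<open>The vector that extends \<open>c\<close> to \<open>p\<close> by \<open>- u / M p p\<close>, with \<open>u = \<Sum>\<^sub>j M p j * c j\<close>, minimizes
  the form of \<open>M\<close> over all extensions of \<open>c\<close>, and the minimum is the form of the Schur complement
  at \<open>c\<close>.\<close>

lemma schur_complement_psd:
  assumes fin: "finite S" and p: "p \<notin> S"
    and herm: "hermitian_on (insert p S) M" and psd: "psd_on (insert p S) M"
  shows "psd_on S (schur_complement p M)"
  unfolding psd_on_def
proof
  fix c :: "'a \<Rightarrow> complex"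
  define u where "u = (\<Sum>j\<in>S. M p j * c j)"
  define d where "d = c(p := - u / M p p)"
  have real: "cnj (M p p) = M p p"
    using herm by (rule hermitian_diag_real) simp
  have u: "(\<Sum>j\<in>S. M p j * d j) = u"
    unfolding u_def by (rule sum.cong) (use p in \<open>auto simp: d_def\<close>)
  have form: "herm_form S M d = herm_form S M c"
    by (rule herm_form_cong) (use p in \<open>auto simp: d_def\<close>)
  have "herm_form S (schur_complement p M) c =
      herm_form S M c - (\<Sum>i\<in>S. \<Sum>j\<in>S. cnj (c i) * (M i p * M p j) * c j) / M p p"
    by (simp add: herm_form_def schur_complement_def sum_subtractf sum_divide_distrib
        algebra_simps)
  also have "\<dots> = herm_form S M c - cnj u * u / M p p"
    by (simp add: herm_form_rank_one[OF herm] u_def)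
  also have "\<dots> = herm_form (insert p S) M d"
    unfolding herm_form_insert[OF fin p herm] u form
    by (simp add: d_def real)
  finally show "0 \<le> herm_form S (schur_complement p M) c"
    using psd by (simp add: psd_on_def)
qed

text \<open>Along the vectors \<open>e\<^sub>j - t M p j e\<^sub>p\<close> the form is affine in the real parameter \<open>t\<close> when
  \<open>M p p = 0\<close>, with slope \<open>-2 \<bar>M p j\<bar>\<^sup>2\<close>; being nonnegative for all \<open>t\<close>, it has slope zero.\<close>

lemma psd_zero_diagonal_row:
  assumes fin: "finite S" and p: "p \<notin> S" and j: "j \<in> S"
    and herm: "hermitian_on (insert p S) M" and psd: "psd_on (insert p S) M"
    and zero: "M p p = 0"
  shows "M p j = 0"
proof (rule ccontr)
  assume nz: "M p j \<noteq> 0"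
  define m where "m = (cmod (M p j))\<^sup>2"
  have m: "m > 0" using nz by (simp add: m_def)
  \<comment> \<open>The parameter at which the affine function takes the value \<open>-1\<close>.\<close>
  define t where "t = (Re (M j j) + 1) / (2 * m)"
  define c where "c = (\<lambda>i. if i = j then 1 else 0)(p := - of_real t * M p j)"
  have "(\<Sum>i\<in>S. M p i * c i) = (\<Sum>i\<in>S. if i = j then M p i else 0)"
    by (rule sum.cong) (use p in \<open>auto simp: c_def\<close>)
  then have u: "(\<Sum>i\<in>S. M p i * c i) = M p j"
    using fin j by simp
  have "herm_form S M c = herm_form S M (\<lambda>i. if i = j then 1 else 0)"
    by (rule herm_form_cong) (use p in \<open>auto simp: c_def\<close>)
  then have form: "herm_form S M c = M j j"
    using herm_form_indicator[OF fin j] by simp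
  have "herm_form (insert p S) M c = M j j - of_real (2 * t) * (M p j * cnj (M p j))"
    unfolding herm_form_insert[OF fin p herm] u form
    by (simp add: c_def zero algebra_simps)
  also have "\<dots> = M j j - of_real (2 * t * m)"
    unfolding m_def complex_norm_square[symmetric] by simp
  finally have "0 \<le> Re (M j j - of_real (2 * t * m))"
    using psd unfolding psd_on_def less_eq_complex_def by (metis zero_complex.sel(1))
  moreover have "2 * t * m = Re (M j j) + 1"
    using m by (simp add: t_def)
  ultimately show False by simp
qed

text \<open>The column of the factor that belongs to the index \<open>p\<close> split off is \<open>M i p / sqrt (M p p)\<close>;
  its contribution is what the Schur complement subtracts. The other columns factorize the Schur
  complement and vanish at \<open>p\<close>.\<close>

theorem hermitian_psd_factorization:
  assumes "finite S" "hermitian_on S M" "psd_on S M"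
  shows "\<exists>a. \<forall>i\<in>S. \<forall>j\<in>S. M i j = (\<Sum>k\<in>S. a i k * cnj (a j k))"
  using assms
proof (induction S arbitrary: M rule: finite_induct)
  case empty
  then show ?case by simp
next
  case (insert p S)
  note fin = insert.hyps(1) and p = insert.hyps(2) and herm = insert.prems(1)
    and psd = insert.prems(2)
  have sym: "cnj (M i j) = M j i" if "i \<in> insert p S" "j \<in> insert p S" for i j
    using herm that by (auto simp: hermitian_on_def)
  have "hermitian_on S (schur_complement p M)"
    unfolding hermitian_on_def schur_complement_def by (simp add: sym mult.commute)
  then obtain b where b: "\<And>i j. i \<in> S \<Longrightarrow> j \<in> S \<Longrightarrow>
      schur_complement p M i j = (\<Sum>k\<in>S. b i k * cnj (b j k))"
    using insert.IH schur_complement_psd[OF fin p herm psd] by blast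
  define r where "r = sqrt (Re (M p p))"
  have "0 \<le> M p p"
    using psd_diag_nonneg[OF _ psd] fin by simp
  then have r: "of_real r * of_real r = M p p"
    by (auto simp: r_def less_eq_complex_def complex_eq_iff)
  have row: "M p j = 0" if "M p p = 0" "j \<in> insert p S" for j
    using that psd_zero_diagonal_row[OF fin p _ herm psd] by auto
  define a where "a = (\<lambda>i k. if k = p then M i p / of_real r else if i = p then 0 else b i k)"
  have "M i j = (\<Sum>k\<in>insert p S. a i k * cnj (a j k))"
    if i: "i \<in> insert p S" and j: "j \<in> insert p S" for i j
  proof -
    have "a i p * cnj (a j p) = M i p * M p j / M p p"
      using j by (simp add: a_def sym r)
    moreover have "(\<Sum>k\<in>S. a i k * cnj (a j k)) = schur_complement p M i j"
    proof (cases "i = p \<or> j = p")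
      case True
      then have "M i j = M i p * M p j / M p p"
      proof (cases "M p p = 0")
        case zero: True
        then have "M p i = 0" "M p j = 0" using row i j by auto
        then have "M i p = 0" "M p j = 0" using sym[of p i] i by auto
        then show ?thesis using True by auto
      qed auto
      moreover have "(\<Sum>k\<in>S. a i k * cnj (a j k)) = 0"
        by (rule sum.neutral) (use True p in \<open>auto simp: a_def\<close>)
      ultimately show ?thesis
        by (simp add: schur_complement_def)
    next
      case False
      have "(\<Sum>k\<in>S. a i k * cnj (a j k)) = (\<Sum>k\<in>S. b i k * cnj (b j k))"
        by (rule sum.cong) (use p False in \<open>auto simp: a_def\<close>)
      then show ?thesis using b False i j by auto
    qed
    ultimately show ?thesis
      using fin p by (simp add: schur_complement_def)
  qed
  then show ?case by blast
qed

section \<open>The lower bound for the Hadamard product with the conjugate\<close>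

lemma norm_sum_squared_le:
  fixes f :: "'a \<Rightarrow> 'b::real_normed_vector"
  shows "(norm (\<Sum>i\<in>I. f i))\<^sup>2 \<le> real (card I) * (\<Sum>i\<in>I. (norm (f i))\<^sup>2)"
proof -
  have "(norm (\<Sum>i\<in>I. f i))\<^sup>2 \<le> (\<Sum>i\<in>I. norm (f i))\<^sup>2"
    by (intro power_mono norm_sum) simp
  also have "\<dots> \<le> (\<Sum>i\<in>I. (norm (f i))\<^sup>2) * real (card I)"
    by (rule sum_squared_le_sum_of_squares)
  finally show ?thesis by (simp add: mult.commute)
qed

text \<open>This is the identity \<open>tr (diag(c)\<^sup>* M diag(c) M) = tr (B\<^sup>* B)\<close> for \<open>M = A A\<^sup>*\<close> and
  \<open>B = A\<^sup>* diag(c) A\<close>, written out in entries.\<close>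

lemma herm_form_norm_square_eq:
  assumes M: "\<And>i j. i \<in> S \<Longrightarrow> j \<in> S \<Longrightarrow> M i j = (\<Sum>p\<in>T. a i p * cnj (a j p))"
  defines "B \<equiv> \<lambda>c p q. \<Sum>k\<in>S. c k * cnj (a k p) * a k q"
  shows "herm_form S (\<lambda>i j. M i j * cnj (M i j)) c =
    of_real (\<Sum>p\<in>T. \<Sum>q\<in>T. (cmod (B c p q))\<^sup>2)"
proof -
  define f where "f i j p q = cnj (c i) * (a i p * cnj (a j p)) * (cnj (a i q) * a j q) * c j"
    for i j p q
  have "herm_form S (\<lambda>i j. M i j * cnj (M i j)) c = (\<Sum>i\<in>S. \<Sum>j\<in>S. \<Sum>p\<in>T. \<Sum>q\<in>T. f i j p q)"
    unfolding herm_form_def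
  proof (intro sum.cong refl)
    fix i j assume "i \<in> S" "j \<in> S"
    then have "M i j * cnj (M i j) =
        (\<Sum>p\<in>T. \<Sum>q\<in>T. (a i p * cnj (a j p)) * (cnj (a i q) * a j q))"
      by (simp add: M sum_product)
    then show "cnj (c i) * (M i j * cnj (M i j)) * c j = (\<Sum>p\<in>T. \<Sum>q\<in>T. f i j p q)"
      by (simp add: f_def sum_distrib_left sum_distrib_right mult.assoc)
  qed
  also have "\<dots> = (\<Sum>i\<in>S. \<Sum>p\<in>T. \<Sum>j\<in>S. \<Sum>q\<in>T. f i j p q)"
    by (intro sum.cong refl sum.swap)
  also have "\<dots> = (\<Sum>p\<in>T. \<Sum>i\<in>S. \<Sum>j\<in>S. \<Sum>q\<in>T. f i j p q)"
    by (rule sum.swap)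
  also have "\<dots> = (\<Sum>p\<in>T. \<Sum>i\<in>S. \<Sum>q\<in>T. \<Sum>j\<in>S. f i j p q)"
    by (intro sum.cong refl sum.swap)
  also have "\<dots> = (\<Sum>p\<in>T. \<Sum>q\<in>T. \<Sum>i\<in>S. \<Sum>j\<in>S. f i j p q)"
    by (intro sum.cong refl sum.swap)
  also have "\<dots> = (\<Sum>p\<in>T. \<Sum>q\<in>T. cnj (B c p q) * B c p q)"
    unfolding B_def cnj_sum sum_product
    by (intro sum.cong refl) (simp add: f_def mult_ac)
  also have "\<dots> = of_real (\<Sum>p\<in>T. \<Sum>q\<in>T. (cmod (B c p q))\<^sup>2)"
    by (simp only: of_real_sum complex_norm_square mult.commute)
  finally show ?thesis .
qed

theorem herm_form_norm_square_ge:
  assumes fin: "finite S" and "hermitian_on S M" "psd_on S M"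
  shows "of_real ((cmod (\<Sum>k\<in>S. M k k * c k))\<^sup>2) \<le>
    of_real (real (card S)) * herm_form S (\<lambda>i j. M i j * cnj (M i j)) c"
proof -
  obtain a where a: "\<And>i j. i \<in> S \<Longrightarrow> j \<in> S \<Longrightarrow> M i j = (\<Sum>p\<in>S. a i p * cnj (a j p))"
    using hermitian_psd_factorization[OF assms] by blast
  define B where "B p q = (\<Sum>k\<in>S. c k * cnj (a k p) * a k q)" for p q
  have "(\<Sum>k\<in>S. M k k * c k) = (\<Sum>k\<in>S. \<Sum>p\<in>S. c k * cnj (a k p) * a k p)"
    by (intro sum.cong refl) (simp add: a sum_distrib_left mult_ac)
  also have "\<dots> = (\<Sum>p\<in>S. B p p)"
    unfolding B_def by (rule sum.swap)
  finally have "(cmod (\<Sum>k\<in>S. M k k * c k))\<^sup>2 \<le> real (card S) * (\<Sum>p\<in>S. (cmod (B p p))\<^sup>2)"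
    using norm_sum_squared_le by metis
  also have "\<dots> \<le> real (card S) * (\<Sum>p\<in>S. \<Sum>q\<in>S. (cmod (B p q))\<^sup>2)"
    by (intro mult_left_mono sum_mono member_le_sum) (auto simp: fin)
  finally have bound: "(cmod (\<Sum>k\<in>S. M k k * c k))\<^sup>2 \<le>
      real (card S) * (\<Sum>p\<in>S. \<Sum>q\<in>S. (cmod (B p q))\<^sup>2)" .
  have "herm_form S (\<lambda>i j. M i j * cnj (M i j)) c =
      of_real (\<Sum>p\<in>S. \<Sum>q\<in>S. (cmod (B p q))\<^sup>2)"
    unfolding B_def by (rule herm_form_norm_square_eq) (rule a)
  with bound show ?thesis
    by (simp only: of_real_mult[symmetric] less_eq_complex_def Re_complex_of_real Im_complex_of_real)
qed

section \<open>Transfer to matrices\<close>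

lemma self_adjoint_iff: "self_adjoint M \<longleftrightarrow> (\<forall>i j. cnj (M $ i $ j) = M $ j $ i)"
  by (auto simp: self_adjoint_def transpose_def mat_cnj_def vec_eq_iff)

lemma self_adjoint_imp_hermitian_on: "self_adjoint M \<Longrightarrow> hermitian_on UNIV (\<lambda>i j. M $ i $ j)"
  by (simp add: self_adjoint_iff hermitian_on_def)

lemma matrix_form_eq_herm_form:
  "(\<Sum>i\<in>UNIV. cnj (c $ i) * (M *v c) $ i) = herm_form UNIV (\<lambda>i j. M $ i $ j) (\<lambda>i. c $ i)"
  by (simp add: herm_form_def matrix_vector_mult_def sum_distrib_left mult.assoc)

lemma pos_semidef_imp_psd_on:
  assumes "pos_semidef M"
  shows "psd_on UNIV (\<lambda>i j. M $ i $ j)"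
  unfolding psd_on_def
proof
  fix c
  have "0 \<le> herm_form UNIV (\<lambda>i j. M $ i $ j) (\<lambda>i. (\<chi> i. c i) $ i)"
    using assms unfolding pos_semidef_def matrix_form_eq_herm_form by blast
  then show "0 \<le> herm_form UNIV (\<lambda>i j. M $ i $ j) c" by simp
qed

lemma diag_col_product_entry:
  "(diag_col M ** transpose (diag_col M)) $ i $ j = M $ i $ i * M $ j $ j"
  by (simp add: diag_col_def columnvector_def matrix_matrix_mult_def transpose_def)

theorem theorem1:
  fixes M :: "complex^'n^'n"
  assumes "self_adjoint M" and "pos_semidef M"
  shows "M \<odot> mat_cnj M \<succeq> (1 / real CARD('n)) *\<^sub>R (diag_col M ** transpose (diag_col M))"
proof -
  define n where "n = real CARD('n)"
  have n: "n > 0" by (simp add: n_def)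
  let ?H = "M \<odot> mat_cnj M" and ?D = "(1 / n) *\<^sub>R (diag_col M ** transpose (diag_col M))"
  have sym: "cnj (M $ i $ j) = M $ j $ i" for i j
    using assms(1) by (simp add: self_adjoint_iff)
  have H: "?H $ i $ j = M $ i $ j * cnj (M $ i $ j)" for i j
    by (simp add: hadamard_def mat_cnj_def)
  have D: "?D $ i $ j = of_real (1 / n) * (M $ i $ i * M $ j $ j)" for i j
    by (simp only: vector_scaleR_component diag_col_product_entry) (simp add: scaleR_conv_of_real)
  have "self_adjoint ?H"
    unfolding self_adjoint_iff H by (simp add: sym)
  moreover have "self_adjoint ?D"
    unfolding self_adjoint_iff D by (simp add: sym mult.commute)
  moreover have "pos_semidef (?H - ?D)"
    unfolding pos_semidef_def
  proof
    fix c :: "complex^'n"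
    define s where "s = (\<Sum>k\<in>UNIV. M $ k $ k * c $ k)"
    define h where "h = herm_form UNIV (\<lambda>i j. M $ i $ j * cnj (M $ i $ j)) (\<lambda>i. c $ i)"
    have "of_real ((cmod s)\<^sup>2) \<le> of_real n * h"
      using herm_form_norm_square_ge[OF finite_class.finite_UNIV
          self_adjoint_imp_hermitian_on[OF assms(1)] pos_semidef_imp_psd_on[OF assms(2)]]
      unfolding s_def h_def n_def by simp
    then have "0 \<le> h - of_real (1 / n) * of_real ((cmod s)\<^sup>2)"
      using n by (auto simp: less_eq_complex_def field_simps)
    also have "of_real ((cmod s)\<^sup>2) = cnj s * s"
      by (simp only: complex_norm_square mult.commute)
    also have "cnj s * s =
        (\<Sum>i\<in>UNIV. \<Sum>j\<in>UNIV. cnj (c $ i) * (M $ i $ i * M $ j $ j) * c $ j)"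
      unfolding s_def cnj_sum sum_product
      by (intro sum.cong refl) (simp add: sym)
    also have "h - of_real (1 / n) * \<dots> = herm_form UNIV (\<lambda>i j. (?H - ?D) $ i $ j) (\<lambda>i. c $ i)"
      unfolding h_def herm_form_def sum_distrib_left sum_subtractf[symmetric]
        vector_minus_component H D
      by (intro sum.cong refl) (simp add: algebra_simps)
    finally show "0 \<le> (\<Sum>i\<in>UNIV. cnj (c $ i) * ((?H - ?D) *v c) $ i)"
      unfolding matrix_form_eq_herm_form .
  qed
  ultimately show ?thesis
    unfolding loewner_ge_def n_def by blast
qed

end
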